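(* Let $n\geq 3$. Then $$\det \tilde H_{K_{n}}={(-1)}^{\binom{n}{2}-1}{2}^{\binom{n}{2}-n+1}n^{n+\binom{n}{2}(n-4)}(n-2).$$ Hence the Hessian $\det H_{K_{n}}$ (a polynomial in the edge variables) is not identically zero for $n\geq 3$.
   Context: For a connected graph $\Gamma$ with edge set $E(\Gamma)$, assign a variable $x_e$ to each edge $e$. The Kirchhoff polynomial is $F_\Gamma=\sum_{T}\prod_{e\in E(T)}x_e$, the sum over all spanning trees $T$ of $\Gamma$. The Hessian matrix of $\Gamma$ is $H_\Gamma=\left(\frac{\partial^2 F_\Gamma}{\partial x_i\partial x_j}\right)_{i,j\in E(\Gamma)}$, and $\tilde H_\Gamma$ denotes $H_\Gamma$ evaluated at $x_e=1$ for all edges $e$. $K_n$ is the complete graph on $n$ vertices. *)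

theory Defs
  imports "HOL-Library.Poly_Mapping" "Jordan_Normal_Form.Determinant"
begin

section \<open>Polynomials in commuting variables indexed by a type\<close>

text \<open>A monomial is a finitely supported exponent vector, and a polynomial is a finitely
  supported family of coefficients indexed by monomials; the ring structure is the convolution
  product of \<^theory>\<open>HOL-Library.Poly_Mapping\<close>.\<close>

type_synonym 'x monomial = "'x \<Rightarrow>\<^sub>0 nat"
type_synonym ('x, 'a) multipoly = "'x monomial \<Rightarrow>\<^sub>0 'a"

definition mvar :: "'x \<Rightarrow> ('x, 'a::comm_ring_1) multipoly" where
  "mvar x = Poly_Mapping.single (Poly_Mapping.single x 1) 1"

definition meval :: "('x \<Rightarrow> 'a) \<Rightarrow> ('x, 'a::comm_ring_1) multipoly \<Rightarrow> 'a" where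
  "meval f p = (\<Sum>m\<in>Poly_Mapping.keys p.
     Poly_Mapping.lookup p m * (\<Prod>x\<in>Poly_Mapping.keys m. f x ^ Poly_Mapping.lookup m x))"

text \<open>In the formal partial derivative the truncated subtraction of exponents is harmless:
  a monomial without \<open>x\<close> gets the coefficient \<open>0\<close>.\<close>

definition mpderiv :: "'x \<Rightarrow> ('x, 'a::comm_ring_1) multipoly \<Rightarrow> ('x, 'a) multipoly" where
  "mpderiv x p = (\<Sum>m\<in>Poly_Mapping.keys p.
     Poly_Mapping.single (m - Poly_Mapping.single x 1)
       (of_nat (Poly_Mapping.lookup m x) * Poly_Mapping.lookup p m))"

text \<open>The list \<open>xs\<close> of variables fixes the order of the rows and columns.\<close>

definition hessian_mat :: "'x list \<Rightarrow> ('x, 'a::comm_ring_1) multipoly \<Rightarrow> ('x, 'a) multipoly mat"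
where
  "hessian_mat xs p =
     mat (length xs) (length xs) (\<lambda>(i, j). mpderiv (xs ! i) (mpderiv (xs ! j) p))"


section \<open>Simple graphs and Kirchhoff polynomials\<close>

text \<open>A simple graph is a pair of a vertex set and a set of edges, each edge being a
  two-element set of vertices.\<close>

type_synonym 'v sgraph = "'v set \<times> 'v set set"

definition connected_graph :: "'v sgraph \<Rightarrow> bool" where
  "connected_graph G \<longleftrightarrow> fst G \<noteq> {} \<and>
     (\<forall>u\<in>fst G. \<forall>v\<in>fst G. (u, v) \<in> {(a, b). {a, b} \<in> snd G}\<^sup>*)"

definition graph_cycle :: "'v sgraph \<Rightarrow> 'v list \<Rightarrow> bool" where
  "graph_cycle G vs \<longleftrightarrow> 3 \<le> length vs \<and> distinct vs \<and>
     (\<forall>i<length vs. {vs ! i, vs ! (Suc i mod length vs)} \<in> snd G)"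

definition tree_graph :: "'v sgraph \<Rightarrow> bool" where
  "tree_graph G \<longleftrightarrow> connected_graph G \<and> (\<nexists>vs. graph_cycle G vs)"

text \<open>A spanning tree contains all vertices, so it is given by its edge set.\<close>

definition spanning_trees :: "'v sgraph \<Rightarrow> 'v set set set" where
  "spanning_trees G = {T. T \<subseteq> snd G \<and> tree_graph (fst G, T)}"

definition kirchhoff_poly :: "'v sgraph \<Rightarrow> ('v set, real) multipoly" where
  "kirchhoff_poly G = (\<Sum>T\<in>spanning_trees G. \<Prod>e\<in>T. mvar e)"

definition complete_graph :: "nat \<Rightarrow> nat sgraph" where
  "complete_graph n = ({1..n}, {e. e \<subseteq> {1..n} \<and> card e = 2})"

end

theory Submission
  imports Defs
begin

text \<open>
  At \<open>x = 1\<close> the off-diagonal Hessian entry at edges \<open>e \<noteq> f\<close> counts the spanning trees of the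
  complete graph containing both, and the diagonal vanishes because the Kirchhoff polynomial is
  multilinear. A forest with \<open>c\<close> components of sizes \<open>s\<^sub>1, \<dots>, s\<^sub>c\<close> lies in
  \<open>n\<^bsup>c - 2\<^esup> s\<^sub>1 \<cdots> s\<^sub>c\<close> spanning trees, so the entry is \<open>(4 - |e \<inter> f|) n\<^bsup>n - 4\<^esup>\<close>.
  Up to the factor \<open>n\<^bsup>n - 4\<^esup>\<close> the matrix is \<open>- 2 I + B C\<close>, where \<open>B\<close> is the edge-vertex
  incidence matrix and \<open>C = (J - I) B\<^sup>T\<close>. Sylvester's determinant identity replaces \<open>B C\<close> by the
  \<open>n \<times> n\<close> matrix \<open>C B\<close>, which gives \<open>- n I + (2 n - 3) J\<close>.
\<close>

section \<open>Determinants\<close>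

text \<open>The block matrix \<open>?M\<close> is made triangular in two ways. Multiplying by
  \<open>?L\<close> on the left clears the block \<open>- A\<close> and leaves the diagonal blocks
  \<open>c I + A B\<close> and \<open>I\<close>; multiplying by \<open>?R\<close> on the right
  leaves \<open>c I\<close> and \<open>c I + B A\<close>. Keeping the powers of \<open>c\<close> on
  both sides avoids a division, so \<open>c = 0\<close> is covered.\<close>

lemma sylvester_det_scaled:
  fixes A B :: "'a::idom mat"
  assumes A: "A \<in> carrier_mat n m" and B: "B \<in> carrier_mat m n"
  shows "c ^ m * det (c \<cdot>\<^sub>m 1\<^sub>m n + A * B) = c ^ n * det (c \<cdot>\<^sub>m 1\<^sub>m m + B * A)"
proof -
  let ?M = "four_block_mat (c \<cdot>\<^sub>m 1\<^sub>m n) (- A) B (1\<^sub>m m)"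
  let ?L = "four_block_mat (1\<^sub>m n) A (0\<^sub>m m n) (1\<^sub>m m)"
  let ?R = "four_block_mat (1\<^sub>m n) A (0\<^sub>m m n) (c \<cdot>\<^sub>m 1\<^sub>m m)"
  have M: "?M \<in> carrier_mat (n + m) (n + m)" and L: "?L \<in> carrier_mat (n + m) (n + m)"
    and R: "?R \<in> carrier_mat (n + m) (n + m)"
    using A B by auto
  have neg_add: "- A + A = 0\<^sub>m n m"
    using A by auto
  have "?L * ?M = four_block_mat (c \<cdot>\<^sub>m 1\<^sub>m n + A * B) (0\<^sub>m n m) B (1\<^sub>m m)"
    by (subst mult_four_block_mat[of _ n n _ m _ m _ _ n _ m], insert A B neg_add, auto)
  then have "det ?L * det ?M = det (c \<cdot>\<^sub>m 1\<^sub>m n + A * B)"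
    using A B det_mult[OF L M]
      det_four_block_mat_upper_right_zero[of "c \<cdot>\<^sub>m 1\<^sub>m n + A * B" n "0\<^sub>m n m" m B "1\<^sub>m m"]
    by auto
  moreover have "det ?L = 1"
    using A det_four_block_mat_lower_left_zero[of "1\<^sub>m n" n A m "0\<^sub>m m n" "1\<^sub>m m"] by auto
  ultimately have detM: "det ?M = det (c \<cdot>\<^sub>m 1\<^sub>m n + A * B)"
    by simp
  have cA: "c \<cdot>\<^sub>m 1\<^sub>m n * A = c \<cdot>\<^sub>m A" "- A * (c \<cdot>\<^sub>m 1\<^sub>m m) = - (c \<cdot>\<^sub>m A)"
    using A by auto
  have "c \<cdot>\<^sub>m A + - (c \<cdot>\<^sub>m A) = 0\<^sub>m n m"
    using A by auto
  then have "?M * ?R = four_block_mat (c \<cdot>\<^sub>m 1\<^sub>m n) (0\<^sub>m n m) B (c \<cdot>\<^sub>m 1\<^sub>m m + B * A)"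
    by (subst mult_four_block_mat[of _ n n _ m _ m _ _ n _ m], insert A B cA,
        auto simp: comm_add_mat[of _ m m])
  then have "det ?M * det ?R = c ^ n * det (c \<cdot>\<^sub>m 1\<^sub>m m + B * A)"
    using A B det_mult[OF M R]
      det_four_block_mat_upper_right_zero[of "c \<cdot>\<^sub>m 1\<^sub>m n" n "0\<^sub>m n m" m B "c \<cdot>\<^sub>m 1\<^sub>m m + B * A"]
    by auto
  moreover have "det ?R = c ^ m"
    using A det_four_block_mat_lower_left_zero[of "1\<^sub>m n" n A m "0\<^sub>m m n" "c \<cdot>\<^sub>m 1\<^sub>m m"] by auto
  ultimately show ?thesis
    using detM by (simp add: mult.commute)
qed

text \<open>The matrix is \<open>a I\<close> plus a product of a column and a row, so Sylvester's
  identity reduces it to a 1 by 1 determinant. Cancelling one factor \<open>a\<close> needs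
  \<open>a\<close> to be nonzero.\<close>

lemma det_scalar_plus_constant_mat:
  fixes a b :: "'a::idom"
  assumes "n \<ge> 1" and "a \<noteq> 0"
  shows "det (mat n n (\<lambda>(i, j). if i = j then a + b else b)) = a ^ (n - 1) * (a + of_nat n * b)"
proof -
  let ?U = "mat n 1 (\<lambda>_. b)" and ?V = "mat 1 n (\<lambda>_. 1 :: 'a)"
  have "mat n n (\<lambda>(i, j). if i = j then a + b else b) = a \<cdot>\<^sub>m 1\<^sub>m n + ?U * ?V"
    by (rule eq_matI) (auto simp: scalar_prod_def)
  moreover have "det (a \<cdot>\<^sub>m 1\<^sub>m 1 + ?V * ?U) = a + of_nat n * b"
    by (subst det_single) (auto simp: scalar_prod_def)
  ultimately have "a * det (mat n n (\<lambda>(i, j). if i = j then a + b else b))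
      = a ^ n * (a + of_nat n * b)"
    using sylvester_det_scaled[of ?U n 1 ?V a] by simp
  then show ?thesis
    using assms by (cases n) (auto simp: mult.assoc)
qed

section \<open>Edges through given vertices, and the determinant of the edge intersection
  matrix\<close>

lemma sum_nth_distinct:
  assumes "distinct xs"
  shows "(\<Sum>i = 0..<length xs. f (xs ! i)) = (\<Sum>x\<in>set xs. f x)"
  using sum.reindex_bij_betw[OF bij_betw_nth[OF assms refl refl], of f]
  by (simp add: atLeast0LessThan)

lemma card_edges_at_vertex:
  assumes "finite V" and "v \<in> V"
  shows "card {e. e \<subseteq> V \<and> card e = 2 \<and> v \<in> e} = card V - 1"
proof -
  have "{e. e \<subseteq> V \<and> card e = 2 \<and> v \<in> e} = (\<lambda>w. {v, w}) ` (V - {v})"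
    using assms(2) by (auto simp: card_2_iff image_iff doubleton_eq_iff)
  moreover have "inj_on (\<lambda>w. {v, w}) (V - {v})"
    by (auto simp: inj_on_def doubleton_eq_iff)
  ultimately show ?thesis
    using assms by (simp add: card_image)
qed

lemma card_edges_through_two_vertices:
  assumes "u \<in> V" and "v \<in> V" and "u \<noteq> v"
  shows "card {e. e \<subseteq> V \<and> card e = 2 \<and> u \<in> e \<and> v \<in> e} = 1"
proof -
  have "{e. e \<subseteq> V \<and> card e = 2 \<and> u \<in> e \<and> v \<in> e} = {{u, v}}"
    using assms by (auto simp: card_2_iff)
  then show ?thesis by simp
qed

lemma det_edge_intersection_mat:
  fixes es :: "nat set list"
  assumes n: "n \<ge> 3" and dist: "distinct es" and es: "set es = {e. e \<subseteq> {1..n} \<and> card e = 2}"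
  defines "N \<equiv> length es"
  shows "det (mat N N (\<lambda>(i, j). (if i = j then 0 else 4 - real (card (es ! i \<inter> es ! j)))))
    = (- 2) ^ (N - n) * ((- real n) ^ (n - 1) * (2 * real n * (real n - 2)))"
proof -
  define B where "B = mat N n (\<lambda>(i, v). if Suc v \<in> es ! i then 1 else 0 :: real)"
  \<comment> \<open>Each column of \<open>J B\<^sup>T\<close> is constantly 2, the size of an edge;
    subtracting \<open>B\<^sup>T\<close> leaves 1 at the ends of the edge and 2 elsewhere.\<close>
  define C where "C = mat n N (\<lambda>(v, j). if Suc v \<in> es ! j then 1 else 2 :: real)"
  have BC: "B \<in> carrier_mat N n" "C \<in> carrier_mat n N"
    by (auto simp: B_def C_def)
  have edge: "es ! i \<subseteq> {1..n}" "card (es ! i) = 2" if "i < N" for i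
    using that es nth_mem[of i es] by (auto simp: N_def)
  have sum_verts: "(\<Sum>v = 0..<n. f (Suc v)) = (\<Sum>v\<in>{1..n}. f v)" for f :: "nat \<Rightarrow> real"
    by (rule sum.reindex_bij_witness[of _ "\<lambda>v. v - 1" Suc]) auto
  have BC_entry: "(B * C) $$ (i, j) = 4 - real (card (es ! i \<inter> es ! j))"
    if ij: "i < N" "j < N" for i j
  proof -
    have "(B * C) $$ (i, j) = (\<Sum>v = 0..<n. (if Suc v \<in> es ! i then 1 else 0)
        * (if Suc v \<in> es ! j then 1 else 2))"
      using ij by (simp add: B_def C_def scalar_prod_def)
    also have "\<dots> = (\<Sum>v\<in>{1..n}. (if v \<in> es ! i then 1 else 0) * (if v \<in> es ! j then 1 else 2))"
      by (rule sum_verts)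
    also have "\<dots> = (\<Sum>v\<in>{1..n}. if v \<in> es ! i then 2 - (if v \<in> es ! j then 1 else 0) else 0)"
      by (rule sum.cong) auto
    also have "\<dots> = (\<Sum>v\<in>es ! i. 2 - (if v \<in> es ! j then 1 else 0))"
      using edge[OF ij(1)] by (simp add: sum.If_cases Int_absorb1)
    also have "\<dots> = 4 - real (card (es ! i \<inter> es ! j))"
      using edge[OF ij(1)] finite_subset[OF edge(1)[OF ij(1)]]
      by (simp add: sum_subtractf sum.If_cases)
    finally show ?thesis .
  qed
  \<comment> \<open>The summand is twice the indicator of \<open>v\<close> in \<open>e\<close> minus
    that of both \<open>u\<close> and \<open>v\<close> in \<open>e\<close>. With
    \<open>n - 1\<close> edges at a vertex and one edge through two vertices, this gives
    \<open>2 (n - 1) - 1\<close> off the diagonal and \<open>n - 1\<close> on it.\<close>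
  have CB_entry: "(C * B) $$ (u, v) = (if u = v then real n - 1 else 2 * real n - 3)"
    if uv: "u < n" "v < n" for u v
  proof -
    have "(C * B) $$ (u, v) = (\<Sum>i = 0..<N. (if Suc u \<in> es ! i then 1 else 2)
        * (if Suc v \<in> es ! i then 1 else 0))"
      using uv by (simp add: B_def C_def scalar_prod_def)
    also have "\<dots> = (\<Sum>e\<in>set es. (if Suc u \<in> e then 1 else 2) * (if Suc v \<in> e then 1 else 0))"
      unfolding N_def by (rule sum_nth_distinct[OF dist])
    also have "\<dots> = (\<Sum>e\<in>set es. 2 * (if Suc v \<in> e then 1 else 0)
        - (if Suc u \<in> e \<and> Suc v \<in> e then 1 else 0))"
      by (rule sum.cong) auto
    also have "\<dots> = 2 * real (card (set es \<inter> {e. Suc v \<in> e}))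
        - real (card (set es \<inter> {e. Suc u \<in> e \<and> Suc v \<in> e}))"
      by (simp add: sum_subtractf sum.If_cases flip: sum_distrib_left)
    also have "set es \<inter> {e. Suc v \<in> e} = {e. e \<subseteq> {1..n} \<and> card e = 2 \<and> Suc v \<in> e}"
      using es by auto
    also have "set es \<inter> {e. Suc u \<in> e \<and> Suc v \<in> e}
        = {e. e \<subseteq> {1..n} \<and> card e = 2 \<and> Suc u \<in> e \<and> Suc v \<in> e}"
      using es by auto
    finally show ?thesis
      using uv n card_edges_at_vertex[of "{1..n}" "Suc v"]
        card_edges_through_two_vertices[of "Suc u" "{1..n}" "Suc v"]
      by (cases "u = v") auto
  qed
  \<comment> \<open>The bound \<open>n \<le> N\<close>, which relies on \<open>n \<ge> 3\<close>,
    makes the truncated difference \<open>N - n\<close> a true one.\<close>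
  have "n choose 2 = N"
    using n_subsets[of "{1..n}" 2] distinct_card[OF dist] es by (simp add: N_def)
  then have "N = n * (n - 1) div 2"
    by (simp add: choose_two)
  moreover have "n * 2 \<le> n * (n - 1)"
    using n by (intro mult_le_mono2) simp
  ultimately have nN: "n \<le> N"
    by linarith
  \<comment> \<open>An edge meets itself in 2 vertices, so \<open>B * C\<close> has 2 on the
    diagonal, which \<open>- 2 I\<close> cancels.\<close>
  have "mat N N (\<lambda>(i, j). (if i = j then 0 else 4 - real (card (es ! i \<inter> es ! j))))
      = (- 2) \<cdot>\<^sub>m 1\<^sub>m N + B * C"
    using BC edge by (intro eq_matI) (auto simp: BC_entry simp del: index_mult_mat(1))
  moreover have "mat n n (\<lambda>(u, v). if u = v then - real n + (2 * real n - 3) else 2 * real n - 3)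
      = (- 2) \<cdot>\<^sub>m 1\<^sub>m n + C * B"
    using BC by (intro eq_matI) (auto simp: CB_entry simp del: index_mult_mat(1))
  \<comment> \<open>Here \<open>a = - n\<close> and \<open>b = 2 n - 3\<close>, so that
    \<open>a + n b = 2 n (n - 2)\<close>.\<close>
  moreover have "det (mat n n (\<lambda>(u, v). if u = v then - real n + (2 * real n - 3)
      else 2 * real n - 3)) = (- real n) ^ (n - 1) * (2 * real n * (real n - 2))"
    using n by (subst det_scalar_plus_constant_mat) (auto simp: algebra_simps)
  ultimately have "(- 2) ^ n * det (mat N N (\<lambda>(i, j).
        (if i = j then 0 else 4 - real (card (es ! i \<inter> es ! j)))))
      = (- 2) ^ N * ((- real n) ^ (n - 1) * (2 * real n * (real n - 2)))"
    using sylvester_det_scaled[OF BC, of "- 2"] by simp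
  moreover have "(- 2 :: real) ^ N = (- 2) ^ n * (- 2) ^ (N - n)"
    using nN by (simp flip: power_add)
  ultimately show ?thesis
    by simp
qed

section \<open>Evaluation and derivatives of polynomials\<close>

lemma mpderiv_add: "mpderiv x (p + q) = mpderiv x p + mpderiv x q"
  unfolding mpderiv_def
  by (rule setsum_keys_plus_distrib) (auto simp: algebra_simps single_add)

lemma mpderiv_sum: "mpderiv x (sum p A) = (\<Sum>a\<in>A. mpderiv x (p a))"
  by (induction A rule: infinite_finite_induct) (auto simp: mpderiv_add, auto simp: mpderiv_def)

lemma mpderiv_single:
  "mpderiv x (Poly_Mapping.single m c)
    = Poly_Mapping.single (m - Poly_Mapping.single x 1) (of_nat (Poly_Mapping.lookup m x) * c)"
  by (simp add: mpderiv_def)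

definition monom_eval :: "('x \<Rightarrow> 'a::comm_ring_1) \<Rightarrow> 'x monomial \<Rightarrow> 'a" where
  "monom_eval f m = (\<Prod>x\<in>Poly_Mapping.keys m. f x ^ Poly_Mapping.lookup m x)"

text \<open>Variables outside the support have exponent 0 and contribute the factor 1. Monomials
  with different supports can thus be compared over one common index set.\<close>

lemma monom_eval_superset:
  assumes "finite S" and "Poly_Mapping.keys m \<subseteq> S"
  shows "monom_eval f m = (\<Prod>x\<in>S. f x ^ Poly_Mapping.lookup m x)"
  unfolding monom_eval_def
  by (rule prod.mono_neutral_left) (use assms in \<open>auto simp: in_keys_iff\<close>)

lemma monom_eval_add: "monom_eval f (m + k) = monom_eval f m * monom_eval f k"
proof -
  let ?S = "Poly_Mapping.keys m \<union> Poly_Mapping.keys k"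
  have "monom_eval f l = (\<Prod>x\<in>?S. f x ^ Poly_Mapping.lookup l x)"
    if "l \<in> {m, k, m + k}" for l
    by (rule monom_eval_superset) (use that keys_add[of m k] in auto)
  then show ?thesis
    by (simp add: lookup_add power_add prod.distrib)
qed

lemma meval_add: "meval f (p + q) = meval f p + meval f q"
  unfolding meval_def
  by (rule setsum_keys_plus_distrib) (auto simp: algebra_simps)

lemma meval_sum: "meval f (sum p A) = (\<Sum>a\<in>A. meval f (p a))"
  by (induction A rule: infinite_finite_induct) (auto simp: meval_add, auto simp: meval_def)

lemma meval_single: "meval f (Poly_Mapping.single m c) = c * monom_eval f m"
  by (simp add: meval_def monom_eval_def)

lemma poly_mapping_sum_singles:
  "p = (\<Sum>m\<in>Poly_Mapping.keys p. Poly_Mapping.single m (Poly_Mapping.lookup p m))"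
  by (rule poly_mapping_eqI) (auto simp: lookup_sum lookup_single when_def in_keys_iff)

lemma meval_mult: "meval f (p * q) = meval f p * meval f q"
proof -
  have "p * q = (\<Sum>m\<in>Poly_Mapping.keys p. \<Sum>k\<in>Poly_Mapping.keys q.
      Poly_Mapping.single (m + k) (Poly_Mapping.lookup p m * Poly_Mapping.lookup q k))"
    by (subst poly_mapping_sum_singles[of p], subst poly_mapping_sum_singles[of q])
      (simp add: sum_product mult_single)
  then have "meval f (p * q) = (\<Sum>m\<in>Poly_Mapping.keys p. \<Sum>k\<in>Poly_Mapping.keys q.
      (Poly_Mapping.lookup p m * monom_eval f m) * (Poly_Mapping.lookup q k * monom_eval f k))"
    by (simp add: meval_sum meval_single monom_eval_add mult_ac)
  then show ?thesis
    by (simp add: meval_def sum_product flip: monom_eval_def)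
qed

text \<open>Ring homomorphisms commute with determinants; this carries nonvanishing at a single
  point over to the Hessian as a polynomial.\<close>

lemma comm_ring_hom_meval: "comm_ring_hom (meval f)"
proof
  have "meval f (Poly_Mapping.single 0 1) = 1"
    by (simp add: meval_def)
  then show "meval f 1 = 1"
    by simp
qed (auto simp: meval_add meval_mult, auto simp: meval_def)

lemma prod_mvar:
  assumes "finite T"
  shows "(\<Prod>e\<in>T. mvar e) = Poly_Mapping.single (\<Sum>e\<in>T. Poly_Mapping.single e 1) 1"
  using assms by (induction T) (auto simp: mvar_def mult_single)

text \<open>All exponents are 0 or 1. Differentiating by \<open>f\<close> removes that variable with
  coefficient 1, so a second derivative by the same variable meets exponent 0, and one by another
  variable of \<open>T\<close> again has coefficient 1.\<close>

lemma meval_ones_mpderiv2_prod_mvar: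
  assumes "finite T"
  shows "meval (\<lambda>_. 1) (mpderiv e (mpderiv f (\<Prod>t\<in>T. mvar t)))
    = (if e \<noteq> f \<and> e \<in> T \<and> f \<in> T then 1 else 0)"
proof -
  have "Poly_Mapping.lookup (\<Sum>t\<in>T. Poly_Mapping.single t (1::nat)) x = (if x \<in> T then 1 else 0)"
    for x
    using assms by (auto simp: lookup_sum lookup_single when_def)
  then show ?thesis
    using assms by (auto simp: prod_mvar mpderiv_single meval_single monom_eval_def lookup_minus
        lookup_single when_def)
qed

section \<open>Spanning trees containing a given forest\<close>

definition conn :: "'v set set \<Rightarrow> 'v rel" where
  "conn F = {(a, b). {a, b} \<in> F}\<^sup>*"

lemma conn_refl: "(x, x) \<in> conn F"
  by (simp add: conn_def)

lemma conn_trans: "(x, y) \<in> conn F \<Longrightarrow> (y, z) \<in> conn F \<Longrightarrow> (x, z) \<in> conn F"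
  unfolding conn_def by (rule rtrancl_trans)

lemma conn_sym: "(x, y) \<in> conn F \<Longrightarrow> (y, x) \<in> conn F"
  using sym_rtrancl[of "{(a, b). {a, b} \<in> F}"] by (auto simp: conn_def sym_def insert_commute)

lemma conn_mono: "(x, y) \<in> conn F \<Longrightarrow> F \<subseteq> G \<Longrightarrow> (x, y) \<in> conn G"
  using rtrancl_mono[of "{(a, b). {a, b} \<in> F}" "{(a, b). {a, b} \<in> G}"]
  unfolding conn_def by blast

lemma conn_edge: "{x, y} \<in> F \<Longrightarrow> (x, y) \<in> conn F"
  by (auto simp: conn_def)

text \<open>A path through the new edge can be shortened to cross it only once, in one of its two
  directions. Formally both orientations are added to the relation, and the redundant cases collapse
  because \<open>conn F\<close> is an equivalence.\<close>

lemma conn_insert: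
  "(x, y) \<in> conn (insert {u, v} F) \<longleftrightarrow> (x, y) \<in> conn F
    \<or> (x, u) \<in> conn F \<and> (v, y) \<in> conn F \<or> (x, v) \<in> conn F \<and> (u, y) \<in> conn F"
proof -
  let ?R = "{(a, b). {a, b} \<in> F}"
  have "{(a, b). {a, b} \<in> insert {u, v} F} = insert (u, v) (insert (v, u) ?R)"
    by (auto simp: doubleton_eq_iff)
  then have "(x, y) \<in> conn (insert {u, v} F) \<longleftrightarrow>
      ((x, y) \<in> conn F \<or> (x, v) \<in> conn F \<and> (u, y) \<in> conn F)
      \<or> ((x, u) \<in> conn F \<or> (x, v) \<in> conn F \<and> (u, u) \<in> conn F)
        \<and> ((v, y) \<in> conn F \<or> (v, v) \<in> conn F \<and> (u, y) \<in> conn F)"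
    by (simp only: conn_def rtrancl_insert Un_iff mem_Collect_eq case_prod_conv)
  then show ?thesis
    using conn_refl[of _ F] conn_trans[of _ _ F] conn_sym[of _ _ F] by blast
qed

text \<open>Acyclicity is encoded as every edge being a bridge, which suits induction on edges
  better than cycles given as lists; \<open>forest_iff_no_cycle\<close> links the two
  notions.\<close>

definition forest :: "'v set set \<Rightarrow> bool" where
  "forest F \<longleftrightarrow> (\<forall>u v. {u, v} \<in> F \<longrightarrow> (u, v) \<notin> conn (F - {{u, v}}))"

lemma forest_subset: "forest F \<Longrightarrow> G \<subseteq> F \<Longrightarrow> forest G"
  unfolding forest_def using conn_mono[of _ _ "G - _" "F - _"] by (meson Diff_mono order_refl subsetD)

text \<open>Suppose an old edge \<open>{a, b}\<close> stopped being a bridge. The detour from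
  \<open>a\<close> to \<open>b\<close> would use \<open>{u, v}\<close>, and its two remaining pieces
  together with \<open>{a, b}\<close> itself would join \<open>u\<close> to \<open>v\<close> inside
  \<open>F\<close>.\<close>

lemma forest_insert:
  assumes "forest F" and "(u, v) \<notin> conn F"
  shows "forest (insert {u, v} F)"
  unfolding forest_def
proof (intro allI impI)
  fix a b assume ab: "{a, b} \<in> insert {u, v} F"
  show "(a, b) \<notin> conn (insert {u, v} F - {{a, b}})"
  proof (cases "{a, b} = {u, v}")
    case True
    have "(x, y) \<notin> conn (insert {u, v} F - {{u, v}})" if "{x, y} = {u, v}" for x y
      using that assms(2) conn_mono[of _ _ "insert {u, v} F - {{u, v}}" F] conn_sym[of v u F]
      by (auto simp: doubleton_eq_iff)
    then show ?thesis
      using True by simp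
  next
    case False
    let ?G = "F - {{a, b}}"
    have G: "insert {u, v} F - {{a, b}} = insert {u, v} ?G"
      using False by auto
    have abF: "{a, b} \<in> F"
      using ab False by simp
    have noab: "(a, b) \<notin> conn ?G"
      using assms(1) abF by (auto simp: forest_def)
    have sub: "(x, y) \<in> conn ?G \<Longrightarrow> (x, y) \<in> conn F" for x y
      by (rule conn_mono) auto
    have "(u, v) \<in> conn F" if "(a, u) \<in> conn ?G" "(v, b) \<in> conn ?G"
      using that sub conn_sym conn_edge[OF abF] by (meson conn_trans)
    moreover have "(u, v) \<in> conn F" if "(a, v) \<in> conn ?G" "(u, b) \<in> conn ?G"
      using that sub conn_sym conn_edge[OF abF] by (meson conn_trans)
    ultimately show ?thesis
      unfolding G conn_insert using noab assms(2) by blast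
  qed
qed

lemma not_conn_of_forest:
  assumes "forest T" and "{u, v} \<in> T" and "F \<subseteq> T" and "{u, v} \<notin> F"
  shows "(u, v) \<notin> conn F"
proof
  assume "(u, v) \<in> conn F"
  then have "(u, v) \<in> conn (T - {{u, v}})"
    by (rule conn_mono) (use assms in auto)
  then show False
    using assms by (auto simp: forest_def)
qed

text \<open>The path grows at its front. If the new first vertex already occurs, the part of the
  path before that occurrence is dropped.\<close>

lemma rtrancl_distinct_path:
  assumes "(x, y) \<in> R\<^sup>*"
  obtains vs where "vs \<noteq> []" "distinct vs" "hd vs = x" "last vs = y"
    "\<And>i. Suc i < length vs \<Longrightarrow> (vs ! i, vs ! Suc i) \<in> R"
proof -
  have "\<exists>vs. vs \<noteq> [] \<and> distinct vs \<and> hd vs = x \<and> last vs = y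
      \<and> (\<forall>i. Suc i < length vs \<longrightarrow> (vs ! i, vs ! Suc i) \<in> R)"
    using assms
  proof (induction rule: converse_rtrancl_induct)
    case base
    show ?case by (rule exI[of _ "[y]"]) simp
  next
    case (step x z)
    then obtain vs where vs: "vs \<noteq> []" "distinct vs" "hd vs = z" "last vs = y"
      "\<And>i. Suc i < length vs \<Longrightarrow> (vs ! i, vs ! Suc i) \<in> R"
      by blast
    show ?case
    proof (cases "x \<in> set vs")
      case True
      then obtain k where k: "k < length vs" "vs ! k = x"
        by (auto simp: in_set_conv_nth)
      show ?thesis
        by (rule exI[of _ "drop k vs"]) (use vs k in \<open>auto simp: hd_drop_conv_nth\<close>)
    next
      case False
      have "((x # vs) ! i, (x # vs) ! Suc i) \<in> R" if "Suc i < length (x # vs)" for i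
        using that vs step(1) by (cases i) (auto simp: hd_conv_nth)
      then show ?thesis
        by (intro exI[of _ "x # vs"]) (use vs False in auto)
    qed
  qed
  then show ?thesis
    using that by blast
qed

text \<open>A cycle minus its closing edge still joins the ends of that edge. Conversely, a path
  without repetitions that bypasses an edge closes up with it to a cycle.\<close>

lemma forest_iff_no_cycle:
  assumes card2: "\<And>e. e \<in> F \<Longrightarrow> card e = 2"
  shows "forest F \<longleftrightarrow> (\<nexists>vs. graph_cycle (V, F) vs)"
proof
  assume forest: "forest F"
  show "\<nexists>vs. graph_cycle (V, F) vs"
  proof
    assume "\<exists>vs. graph_cycle (V, F) vs"
    then obtain vs where len: "3 \<le> length vs" and dist: "distinct vs"
      and edge: "\<And>i. i < length vs \<Longrightarrow> {vs ! i, vs ! (Suc i mod length vs)} \<in> F"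
      by (auto simp: graph_cycle_def)
    define k where "k = length vs - 1"
    have k: "length vs = Suc k" "k \<ge> 2"
      using len by (auto simp: k_def)
    let ?e = "{vs ! 0, vs ! k}"
    \<comment> \<open>At index \<open>k\<close> the successor modulo the length wraps around to
      0.\<close>
    have e: "?e \<in> F"
      using edge[of k] k by (simp add: insert_commute)
    have "(vs ! 0, vs ! i) \<in> conn (F - {?e})" if "i \<le> k" for i
      using that
    proof (induction i)
      case (Suc i)
      have "{vs ! i, vs ! Suc i} \<in> F"
        using edge[of i] Suc.prems k by simp
      moreover have "{vs ! i, vs ! Suc i} \<noteq> ?e"
        using dist Suc.prems k by (auto simp: doubleton_eq_iff nth_eq_iff_index_eq)
      ultimately have "(vs ! i, vs ! Suc i) \<in> conn (F - {?e})"
        by (intro conn_edge) simp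
      then show ?case
        using Suc by (meson Suc_leD conn_trans)
    qed (rule conn_refl)
    then show False
      using forest e by (auto simp: forest_def)
  qed
next
  assume acyc: "\<nexists>vs. graph_cycle (V, F) vs"
  show "forest F"
    unfolding forest_def
  proof (intro allI impI notI)
    fix u v assume uv: "{u, v} \<in> F" and "(u, v) \<in> conn (F - {{u, v}})"
    then obtain vs where vs: "vs \<noteq> []" "distinct vs" "hd vs = u" "last vs = v"
      "\<And>i. Suc i < length vs \<Longrightarrow> (vs ! i, vs ! Suc i) \<in> {(a, b). {a, b} \<in> F - {{u, v}}}"
      unfolding conn_def using rtrancl_distinct_path by metis
    have hl: "vs ! 0 = u" "vs ! (length vs - 1) = v"
      using vs by (auto simp: hd_conv_nth last_conv_nth)
    have "u \<noteq> v"
      using card2[OF uv] by auto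
    \<comment> \<open>One vertex would force \<open>u = v\<close>, and two vertices would make the
      path use the removed edge; hence at least three remain.\<close>
    then have "length vs \<noteq> 1"
      using hl by auto
    moreover have "length vs \<noteq> 2"
      using vs(5)[of 0] hl by auto
    ultimately have "3 \<le> length vs"
      using vs(1) by (cases "length vs") auto
    moreover have "{vs ! i, vs ! (Suc i mod length vs)} \<in> F" if "i < length vs" for i
    proof (cases "Suc i < length vs")
      case True
      then show ?thesis using vs(5)[of i] by simp
    next
      case False
      then have "Suc i = length vs" "i = length vs - 1"
        using that by auto
      then show ?thesis
        using hl uv by (simp add: insert_commute)
    qed
    ultimately have "graph_cycle (V, F) vs"
      using vs(2) by (simp add: graph_cycle_def)
    then show False
      using acyc by blast
  qed
qed

section \<open>Components and their sizes\<close>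

definition edges_on :: "'v set \<Rightarrow> 'v set set" where
  "edges_on V = {e. e \<subseteq> V \<and> card e = 2}"

definition component :: "'v set set \<Rightarrow> 'v \<Rightarrow> 'v set" where
  "component F x = {y. (x, y) \<in> conn F}"

definition components :: "'v set \<Rightarrow> 'v set set \<Rightarrow> 'v set set" where
  "components V F = component F ` V"

definition trees_above :: "'v set \<Rightarrow> 'v set set \<Rightarrow> 'v set set set" where
  "trees_above V F = {T. F \<subseteq> T \<and> T \<subseteq> edges_on V \<and> forest T \<and> connected_graph (V, T)}"

lemma finite_edges_on: "finite V \<Longrightarrow> finite (edges_on V)"
  by (simp add: edges_on_def)

lemma edges_onE:
  assumes "e \<in> edges_on V"
  obtains u v where "e = {u, v}" "u \<noteq> v" "u \<in> V" "v \<in> V"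
  using assms by (auto simp: edges_on_def card_2_iff)

lemma doubleton_edges_on: "{u, v} \<in> edges_on V \<longleftrightarrow> u \<in> V \<and> v \<in> V \<and> u \<noteq> v"
  by (cases "u = v") (auto simp: edges_on_def)

lemma self_in_component: "x \<in> component F x"
  by (simp add: component_def conn_refl)

lemma component_eq_iff: "component F x = component F y \<longleftrightarrow> (x, y) \<in> conn F"
proof
  show "(x, y) \<in> conn F" if "component F x = component F y"
    using that self_in_component[of y F] by (auto simp: component_def)
  show "component F x = component F y" if "(x, y) \<in> conn F"
    using that conn_sym[OF that] by (auto simp: component_def intro: conn_trans)
qed

lemma component_subset:
  assumes "F \<subseteq> edges_on V" and "x \<in> V"
  shows "component F x \<subseteq> V"
proof
  fix y assume "y \<in> component F x"
  then have "(x, y) \<in> {(a, b). {a, b} \<in> F}\<^sup>*"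
    by (simp add: component_def conn_def)
  then show "y \<in> V"
    by (induction rule: rtrancl_induct) (use assms in \<open>auto simp: doubleton_edges_on subset_iff\<close>)
qed

lemma card_component_pos:
  assumes "finite V" and "F \<subseteq> edges_on V" and "x \<in> V"
  shows "card (component F x) > 0"
  using finite_subset[OF component_subset[OF assms(2,3)] assms(1)] self_in_component[of x F]
  by (auto simp: card_gt_0_iff)

lemma component_empty: "component {} x = {x}"
  by (simp add: component_def conn_def)

lemma component_insert:
  "component (insert {u, v} F) x
    = (if x \<in> component F u \<union> component F v then component F u \<union> component F v else component F x)"
proof -
  consider "(u, x) \<in> conn F" | "(v, x) \<in> conn F" | "(u, x) \<notin> conn F" "(v, x) \<notin> conn F"
    by blast
  then show ?thesis
  proof cases
    case 1
    then have "(x, y) \<in> conn F \<longleftrightarrow> (u, y) \<in> conn F" for y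
      by (meson conn_trans conn_sym)
    then show ?thesis
      using 1 by (auto simp: component_def conn_insert conn_refl intro: conn_trans)
  next
    case 2
    then have "(x, y) \<in> conn F \<longleftrightarrow> (v, y) \<in> conn F" for y
      by (meson conn_trans conn_sym)
    then show ?thesis
      using 2 by (auto simp: component_def conn_insert conn_refl intro: conn_trans)
  next
    case 3
    then have "(x, u) \<notin> conn F" "(x, v) \<notin> conn F"
      by (meson conn_sym)+
    then show ?thesis
      using 3 by (auto simp: component_def conn_insert)
  qed
qed

lemma component_disjoint:
  "(u, v) \<notin> conn F \<Longrightarrow> component F u \<inter> component F v = {}"
  by (auto simp: component_def dest: conn_sym[of v] conn_trans)

lemma components_insert:
  assumes "u \<in> V" and "v \<in> V"
  shows "components V (insert {u, v} F) = insert (component F u \<union> component F v)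
    (components V F - {component F u, component F v})"
proof -
  have "x \<in> component F u \<union> component F v
      \<longleftrightarrow> component F x = component F u \<or> component F x = component F v" for x
    unfolding component_eq_iff using conn_sym by (fastforce simp: component_def)
  then show ?thesis
    using assms self_in_component[of u F] unfolding components_def component_insert by force
qed

text \<open>Makes the \<open>insert\<close> in \<open>components_insert\<close> a genuine addition,
  so that cardinalities and products split. A component equal to the union contains \<open>u\<close>
  and is therefore the component of \<open>u\<close>.\<close>

lemma merged_component_notin:
  "component F u \<union> component F v \<notin> components V F - {component F u, component F v}"
proof
  assume "component F u \<union> component F v \<in> components V F - {component F u, component F v}"
  then obtain x where x: "component F u \<union> component F v = component F x"
    "component F x \<noteq> component F u"
    by (auto simp: components_def)
  have "u \<in> component F x"
    using self_in_component[of u F] x(1) by blast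
  then show False
    using x(2) unfolding component_eq_iff by (simp add: component_def)
qed

lemma card_components_insert:
  assumes "finite V" and "u \<in> V" and "v \<in> V" and "(u, v) \<notin> conn F"
  shows "Suc (card (components V (insert {u, v} F))) = card (components V F)"
proof -
  have fin: "finite (components V F)"
    using assms by (simp add: components_def)
  have in_comps: "component F u \<in> components V F" "component F v \<in> components V F"
    "component F u \<noteq> component F v"
    using assms by (auto simp: components_def component_eq_iff)
  have "card {component F u, component F v} \<le> card (components V F)"
    by (rule card_mono) (use fin in_comps in auto)
  then show ?thesis
    using fin in_comps merged_component_notin[of F u v V]
    unfolding components_insert[OF assms(2,3)]
    by (simp add: card_Diff_subset)
qed

text \<open>The factors \<open>s\<close> and \<open>t\<close> of the merged components are replaced
  by \<open>s + t\<close>. The equation is multiplied by \<open>s t\<close> to stay within the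
  natural numbers.\<close>

lemma prod_card_components_insert:
  assumes "finite V" and "F \<subseteq> edges_on V" and "u \<in> V" and "v \<in> V" and "(u, v) \<notin> conn F"
  shows "(\<Prod>C\<in>components V (insert {u, v} F). card C) * (card (component F u) * card (component F v))
    = (\<Prod>C\<in>components V F. card C) * (card (component F u) + card (component F v))"
proof -
  let ?U = "component F u" and ?W = "component F v"
  have fin: "finite (components V F)"
    using assms by (simp add: components_def)
  have in_comps: "?U \<in> components V F" "?W \<in> components V F" "?U \<noteq> ?W"
    using assms by (auto simp: components_def component_eq_iff)
  have fin2: "finite ?U" "finite ?W"
    using component_subset[OF assms(2)] assms finite_subset by blast+
  have "(\<Prod>C\<in>components V F. card C) = (\<Prod>C\<in>components V F - {?U, ?W}. card C) * (card ?U * card ?W)"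
    using prod.subset_diff[of "{?U, ?W}" "components V F" card] fin in_comps by simp
  moreover have "(\<Prod>C\<in>components V (insert {u, v} F). card C)
      = (card ?U + card ?W) * (\<Prod>C\<in>components V F - {?U, ?W}. card C)"
    unfolding components_insert[OF assms(3,4)]
    using fin merged_component_notin[of F u v V] card_Un_disjoint[OF fin2 component_disjoint[OF assms(5)]]
    by simp
  ultimately show ?thesis
    by simp
qed

lemma card_components_empty: "card (components V {}) = card V"
proof -
  have "components V {} = (\<lambda>x. {x}) ` V"
    by (simp add: components_def component_empty[abs_def])
  then show ?thesis
    by (simp add: card_image)
qed

lemma prod_card_components_empty: "(\<Prod>C\<in>components V {}. card C) = 1"
  by (rule prod.neutral) (auto simp: components_def component_empty)

text \<open>Starting from singletons, each edge of a forest joins two distinct components and so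
  lowers their number by one.\<close>

lemma card_forest_plus_components:
  assumes "finite V" and "F \<subseteq> edges_on V" and "forest F"
  shows "card F + card (components V F) = card V"
proof -
  have "finite F"
    using assms(1,2) finite_edges_on finite_subset by blast
  then show ?thesis
    using assms(2,3)
  proof (induction F)
    case empty
    then show ?case by (simp add: card_components_empty)
  next
    case (insert e F)
    obtain u v where uv: "e = {u, v}" "u \<in> V" "v \<in> V"
      using edges_onE[of e V] insert.prems by blast
    have "(u, v) \<notin> conn F"
      by (rule not_conn_of_forest[OF insert.prems(2)]) (use uv insert in auto)
    then have "Suc (card (components V (insert e F))) = card (components V F)"
      using card_components_insert[OF assms(1)] uv by blast
    moreover have "forest F"
      using insert.prems(2) by (rule forest_subset) auto
    ultimately show ?case
      using insert by simp
  qed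
qed

lemma components_connected:
  assumes "F \<subseteq> edges_on V" and "connected_graph (V, F)"
  shows "components V F = {V}"
proof -
  have "component F x = V" if "x \<in> V" for x
    using component_subset[OF assms(1) that] that assms(2)
    by (auto simp: connected_graph_def component_def conn_def)
  then show ?thesis
    using assms(2) by (auto simp: components_def connected_graph_def)
qed

lemma connected_if_one_component:
  assumes "card (components V F) = 1"
  shows "connected_graph (V, F)"
proof -
  obtain C where C: "components V F = {C}"
    using assms by (auto simp: card_1_singleton_iff)
  then have "component F x = C" if "x \<in> V" for x
    using that by (auto simp: components_def)
  then have "(x, y) \<in> conn F" if "x \<in> V" "y \<in> V" for x y
    using that component_eq_iff[of F x y] by blast
  moreover have "V \<noteq> {}"
    using C by (auto simp: components_def)
  ultimately show ?thesis
    by (simp add: connected_graph_def conn_def)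
qed

section \<open>Double counting of the trees that contain a forest\<close>

lemma card_ordered_edges:
  assumes "finite S" and "S \<subseteq> edges_on V"
  shows "card {(u, v). {u, v} \<in> S} = 2 * card S \<and> finite {(u, v). {u, v} \<in> S}"
  using assms
proof (induction S)
  case (insert e S)
  obtain a b where ab: "e = {a, b}" "a \<noteq> b"
    using edges_onE[of e V] insert.prems by blast
  have "{(u, v). {u, v} \<in> insert e S} = insert (a, b) (insert (b, a) {(u, v). {u, v} \<in> S})"
    using ab by (auto simp: doubleton_eq_iff)
  then show ?case
    using insert ab by (auto simp: insert_commute)
qed simp

text \<open>A component of size \<open>s\<close> contributes \<open>s\<close> terms
  \<open>1 / s\<close>, hence 1 in total.\<close>

lemma sum_inverse_card_component:
  assumes "finite V" and "F \<subseteq> edges_on V"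
  shows "(\<Sum>x\<in>V. 1 / real (card (component F x))) = real (card (components V F))"
proof -
  have "(\<Sum>x\<in>V. 1 / real (card (component F x)))
      = (\<Sum>C\<in>components V F. \<Sum>x\<in>{x \<in> V. component F x = C}. 1 / real (card (component F x)))"
    unfolding components_def by (rule sum.image_gen[OF assms(1)])
  also have "\<dots> = (\<Sum>C\<in>components V F. 1)"
  proof (rule sum.cong)
    fix C assume "C \<in> components V F"
    then obtain y where y: "y \<in> V" "C = component F y"
      by (auto simp: components_def)
    have sub: "C \<subseteq> V"
      using component_subset[OF assms(2)] y by blast
    have "{x \<in> V. component F x = C} = C"
      using sub conn_sym unfolding y(2) component_eq_iff by (fastforce simp: component_def)
    moreover have "card C > 0"
      using card_component_pos[OF assms y(1)] y(2) by simp
    ultimately show "(\<Sum>x\<in>{x \<in> V. component F x = C}. 1 / real (card (component F x))) = 1"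
      by (subst sum.cong[OF refl, of _ _ "\<lambda>_. 1 / real (card C)"]) auto
  qed simp
  finally show ?thesis by simp
qed

text \<open>Swapping the pair shows that both summands contribute equally. For fixed
  \<open>u\<close> in a component of size \<open>s\<close> there are \<open>n - s\<close> partners,
  giving \<open>n / s - 1\<close>; summing over \<open>u\<close> gives \<open>n c - n\<close> for
  \<open>c\<close> components.\<close>

lemma sum_unconnected_pairs:
  assumes "finite V" and "F \<subseteq> edges_on V"
  shows "(\<Sum>(u, v)\<in>V \<times> V - conn F.
      1 / real (card (component F u)) + 1 / real (card (component F v)))
    = 2 * real (card V) * (real (card (components V F)) - 1)"
proof -
  let ?s = "\<lambda>u. real (card (component F u))"
  let ?D = "V \<times> V - conn F"
  have fin: "finite ?D"
    using assms by simp
  have "(\<Sum>(u, v)\<in>?D. 1 / ?s v) = (\<Sum>(u, v)\<in>?D. 1 / ?s u)"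
    by (rule sum.reindex_bij_witness[of _ prod.swap prod.swap]) (auto dest: conn_sym)
  moreover have "(\<Sum>(u, v)\<in>?D. 1 / ?s u) = real (card V) * (real (card (components V F)) - 1)"
  proof -
    have D: "?D = Sigma V (\<lambda>u. V - component F u)"
      by (auto simp: component_def)
    have "(\<Sum>v\<in>V - component F u. 1 / ?s u) = real (card V) * (1 / ?s u) - 1" if "u \<in> V" for u
    proof -
      have sub: "component F u \<subseteq> V"
        by (rule component_subset[OF assms(2) that])
      have "?s u > 0"
        using card_component_pos[OF assms that] by simp
      moreover have "real (card (V - component F u)) = real (card V) - ?s u"
        using sub assms(1) by (simp add: card_Diff_subset finite_subset card_mono of_nat_diff)
      ultimately show ?thesis
        by (simp add: field_simps)
    qed
    then have "(\<Sum>(u, v)\<in>?D. 1 / ?s u) = (\<Sum>u\<in>V. real (card V) * (1 / ?s u) - 1)"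
      unfolding D by (subst sum.Sigma[symmetric]) (use assms in auto)
    also have "\<dots> = real (card V) * (\<Sum>u\<in>V. 1 / ?s u) - real (card V)"
      by (simp add: sum_subtractf sum_distrib_left)
    also have "\<dots> = real (card V) * (real (card (components V F)) - 1)"
      unfolding sum_inverse_card_component[OF assms] by (simp add: algebra_simps)
    finally show ?thesis .
  qed
  ultimately show ?thesis
    by (simp add: case_prod_unfold sum.distrib)
qed

text \<open>Counting the pairs of a tree \<open>T \<supseteq> F\<close> and an oriented edge of \<open>T - F\<close> in two ways expresses the count for \<open>F\<close> through the counts for the
  forests with one more edge.\<close>

lemma card_trees_above:
  assumes "finite V" and "V \<noteq> {}" and "F \<subseteq> edges_on V" and "forest F"
  shows "real (card (trees_above V F)) * real (card V) ^ 2
    = real (card V) ^ card (components V F) * (\<Prod>C\<in>components V F. card C)"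
  using assms(3,4)
proof (induction "card (components V F)" arbitrary: F rule: less_induct)
  case less
  define n where "n = card V"
  define c where "c = card (components V F)"
  have finE: "finite (edges_on V)"
    using assms(1) by (rule finite_edges_on)
  have fin_trees: "finite (trees_above V F)"
    by (rule finite_subset[of _ "Pow (edges_on V)"]) (auto simp: trees_above_def finE)
  have cF: "card F + c = n"
    unfolding n_def c_def by (rule card_forest_plus_components[OF assms(1) less.prems])
  have card_tree: "card T + 1 = n" if "T \<in> trees_above V F" for T
    using that card_forest_plus_components[OF assms(1), of T] components_connected[of T V]
    by (simp add: trees_above_def n_def)
  have "c > 0"
    using assms by (simp add: c_def card_gt_0_iff components_def)
  show ?case
  \<comment> \<open>With one component \<open>F\<close> is itself a spanning tree. Every tree above
    it has the same number \<open>n - 1\<close> of edges and so equals \<open>F\<close>.\<close>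
  proof (cases "c = 1")
    case True
    then have conF: "connected_graph (V, F)"
      by (auto simp: c_def intro: connected_if_one_component)
    have "T = F" if T: "T \<in> trees_above V F" for T
    proof -
      have "finite T" "F \<subseteq> T"
        using T finE finite_subset by (auto simp: trees_above_def)
      then show ?thesis
        using card_tree[OF T] cF True card_subset_eq[of T F] by simp
    qed
    then have "trees_above V F = {F}"
      using conF less.prems by (auto simp: trees_above_def)
    then show ?thesis
      using components_connected[OF less.prems(1) conF] by (simp add: power2_eq_square)
  next
    case False
    then have c1: "c > 1"
      using \<open>c > 0\<close> by simp
    let ?D = "V \<times> V - conn F"
    let ?P = "real (\<Prod>C\<in>components V F. card C)"
    let ?s = "\<lambda>u. real (card (component F u))"
    have finD: "finite ?D"
      using assms by simp
    \<comment> \<open>Count per tree. An edge of \<open>F\<close> connects its ends in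
      \<open>F\<close>, while no edge of \<open>T - F\<close> does, so the pairs in
      \<open>?D\<close> that are edges of \<open>T\<close> are the orientations of the edges of
      \<open>T - F\<close>. There are \<open>(n - 1) - (n - c) = c - 1\<close> such edges, each with
      two orientations.\<close>
    have "(\<Sum>T\<in>trees_above V F. \<Sum>(u, v)\<in>?D. if {u, v} \<in> T then 1 else 0 :: real)
        = (\<Sum>T\<in>trees_above V F. 2 * (real c - 1))"
    proof (rule sum.cong)
      fix T assume T: "T \<in> trees_above V F"
      then have T': "F \<subseteq> T" "T \<subseteq> edges_on V" "forest T" and finT: "finite T"
        using finE finite_subset by (auto simp: trees_above_def)
      have "(\<Sum>(u, v)\<in>?D. if {u, v} \<in> T then 1 else 0 :: real)
          = real (card (?D \<inter> {(u, v). {u, v} \<in> T}))"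
        using finD by (simp add: case_prod_unfold sum.If_cases)
      also have "?D \<inter> {(u, v). {u, v} \<in> T} = {(u, v). {u, v} \<in> T - F}"
        using T' not_conn_of_forest[OF T'(3) _ T'(1)] conn_edge[of _ _ F]
        by (auto simp: doubleton_edges_on subset_iff)
      also have "card \<dots> = 2 * card (T - F)"
        using card_ordered_edges[of "T - F" V] finT T' by auto
      also have "card (T - F) = c - 1"
        using T' finT card_tree[OF T] cF by (simp add: card_Diff_subset finite_subset)
      finally show "(\<Sum>(u, v)\<in>?D. if {u, v} \<in> T then 1 else 0 :: real) = 2 * (real c - 1)"
        using c1 by (simp add: of_nat_diff)
    qed simp
    also have "\<dots> = 2 * (real c - 1) * real (card (trees_above V F))"
      by simp
    finally have lhs: "(\<Sum>(u, v)\<in>?D. \<Sum>T\<in>trees_above V F. if {u, v} \<in> T then 1 else 0 :: real)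
        = 2 * (real c - 1) * real (card (trees_above V F))"
      by (subst (asm) sum.swap) (simp add: case_prod_unfold)
    \<comment> \<open>Count per pair. The trees containing \<open>{u, v}\<close> are those above the
      enlarged forest, which has \<open>c - 1\<close> components. Merging sizes \<open>s\<close> and
      \<open>t\<close> multiplies the product by
      \<open>(s + t) / (s t) = 1 / s + 1 / t\<close>.\<close>
    have rhs: "(\<Sum>T\<in>trees_above V F. if {u, v} \<in> T then 1 else 0 :: real) * real n ^ 2
        = real n ^ (c - 1) * ?P * (1 / ?s u + 1 / ?s v)"
      if uv: "(u, v) \<in> ?D" for u v
    proof -
      let ?F = "insert {u, v} F"
      have uv': "u \<in> V" "v \<in> V" "(u, v) \<notin> conn F"
        using uv by auto
      then have "u \<noteq> v"
        using conn_refl by metis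
      then have subF: "?F \<subseteq> edges_on V"
        using uv' less.prems by (simp add: doubleton_edges_on)
      have cc: "Suc (card (components V ?F)) = c"
        unfolding c_def by (rule card_components_insert[OF assms(1) uv'])
      have "(\<Sum>T\<in>trees_above V F. if {u, v} \<in> T then 1 else 0 :: real)
          = real (card (trees_above V F \<inter> {T. {u, v} \<in> T}))"
        using fin_trees by (simp add: sum.If_cases)
      also have "trees_above V F \<inter> {T. {u, v} \<in> T} = trees_above V ?F"
        by (auto simp: trees_above_def)
      also have "real (card (trees_above V ?F)) * real n ^ 2
          = real n ^ card (components V ?F) * real (\<Prod>C\<in>components V ?F. card C)"
        unfolding n_def
        by (rule less.hyps[OF _ subF forest_insert[OF less.prems(2) uv'(3)]])
          (use cc c_def in simp)
      also have "card (components V ?F) = c - 1"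
        using cc by simp
      finally have 1: "(\<Sum>T\<in>trees_above V F. if {u, v} \<in> T then 1 else 0 :: real) * real n ^ 2
        = real n ^ (c - 1) * real (\<Prod>C\<in>components V ?F. card C)" .
      have "?s u > 0" "?s v > 0"
        using card_component_pos[OF assms(1) less.prems(1)] uv' by simp_all
      moreover have "real (\<Prod>C\<in>components V ?F. card C) * (?s u * ?s v) = ?P * (?s u + ?s v)"
        using prod_card_components_insert[OF assms(1) less.prems(1) uv']
        by (metis of_nat_add of_nat_mult)
      ultimately have "real (\<Prod>C\<in>components V ?F. card C) = ?P * (1 / ?s u + 1 / ?s v)"
        by (simp add: field_simps del: of_nat_prod)
      then show ?thesis
        using 1 by (simp add: mult.assoc del: of_nat_prod)
    qed
    have "(\<Sum>(u, v)\<in>?D. \<Sum>T\<in>trees_above V F. if {u, v} \<in> T then 1 else 0 :: real) * real n ^ 2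
        = (\<Sum>(u, v)\<in>?D. real n ^ (c - 1) * ?P * (1 / ?s u + 1 / ?s v))"
      by (subst sum_distrib_right) (rule sum.cong, use rhs in auto)
    also have "\<dots> = real n ^ (c - 1) * ?P * (\<Sum>(u, v)\<in>?D. 1 / ?s u + 1 / ?s v)"
      unfolding sum_distrib_left by (simp add: case_prod_unfold del: of_nat_prod)
    also have "\<dots> = real n ^ (c - 1) * ?P * (2 * real n * (real c - 1))"
      unfolding sum_unconnected_pairs[OF assms(1) less.prems(1)] n_def c_def ..
    \<comment> \<open>The factor \<open>n\<close> from \<open>sum_unconnected_pairs\<close> raises
      the exponent \<open>c - 1\<close> to \<open>c\<close>; the factor \<open>2 (c - 1)\<close>
      occurs in both counts and is nonzero because \<open>c > 1\<close>.\<close>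
    also have "\<dots> = 2 * (real c - 1) * (real n ^ c * ?P)"
      using c1 by (cases c) (auto simp del: of_nat_prod)
    finally have "2 * (real c - 1) * (real (card (trees_above V F)) * real n ^ 2)
        = 2 * (real c - 1) * (real n ^ c * ?P)"
      unfolding lhs by (simp add: mult.assoc del: of_nat_prod)
    then show ?thesis
      using c1 by (simp add: n_def c_def del: of_nat_prod)
  qed
qed

lemma forest_empty: "forest {}"
  by (simp add: forest_def)

text \<open>The two edges leave \<open>n - 2\<close> components. The product of their sizes is
  \<open>2 * 2\<close> for disjoint edges and 3 for edges sharing a vertex, which is 4 minus the
  size of the intersection in both cases. The factor \<open>n ^ 4\<close> avoids the exponent
  \<open>n - 4\<close>, negative for \<open>n = 3\<close>.\<close>

lemma card_trees_above_two_edges: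
  assumes "finite V" and "e \<in> edges_on V" and "f \<in> edges_on V" and "e \<noteq> f"
  shows "real (card (trees_above V {e, f})) * real (card V) ^ 4
    = (4 - real (card (e \<inter> f))) * real (card V) ^ card V"
proof -
  obtain a b where ab: "e = {a, b}" "a \<noteq> b" "a \<in> V" "b \<in> V"
    using assms(2) by (rule edges_onE)
  \<comment> \<open>The ends of \<open>f\<close> are named so that \<open>d\<close> is outside
    \<open>e\<close>. Adding \<open>f\<close> to \<open>{e}\<close> then merges the singleton of
    \<open>d\<close> with the component of \<open>c\<close>, which is \<open>e\<close> or a
    singleton.\<close>
  obtain c d where cd: "f = {c, d}" "c \<noteq> d" "c \<in> V" "d \<in> V" "d \<notin> e"
  proof -
    obtain c d where "f = {c, d}" "c \<noteq> d" "c \<in> V" "d \<in> V"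
      using assms(3) by (rule edges_onE)
    then show thesis
      using that[of c d] that[of d c] assms(4) ab by (cases "d \<in> e") auto
  qed
  have card_e2: "card e = 2"
    using assms(2) by (simp add: edges_on_def)
  have comp_e: "component {e} x = (if x \<in> e then e else {x})" for x
    using component_insert[of a b "{}" x] ab by (auto simp: component_empty)
  have "(a, b) \<notin> conn {}"
    using ab component_empty[of a] unfolding component_def by auto
  note e_ins = forest_insert[OF forest_empty this]
    card_components_insert[OF assms(1) ab(3,4) this]
    prod_card_components_insert[OF assms(1) empty_subsetI ab(3,4) this]
  have forest_e: "forest {e}" and card_e: "Suc (card (components V {e})) = card V"
    and prod_e: "(\<Prod>C\<in>components V {e}. card C) = 2"
    using e_ins ab(1) by (simp_all add: card_components_empty prod_card_components_empty component_empty)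
  have "(c, d) \<notin> conn {e}"
    using component_eq_iff[of "{e}" c d] cd comp_e by (auto split: if_splits)
  note f_ins = forest_insert[OF forest_e this]
    card_components_insert[OF assms(1) cd(3,4) this]
    prod_card_components_insert[OF assms(1) _ cd(3,4) this]
  have ef: "insert {c, d} {e} = {e, f}"
    using cd by auto
  have card_ef: "card (components V {e, f}) + 2 = card V"
    using f_ins(2) card_e unfolding ef by simp
  have prod_ef: "real (\<Prod>C\<in>components V {e, f}. card C) = 4 - real (card (e \<inter> f))"
  proof (cases "c \<in> e")
    case True
    then have "e \<inter> f = {c}"
      using cd by auto
    then show ?thesis
      using f_ins(3) assms(2) cd True card_e2 unfolding ef
      by (simp add: comp_e prod_e del: of_nat_prod)
  next
    case False
    then have "e \<inter> f = {}"
      using cd by auto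
    then show ?thesis
      using f_ins(3) assms(2) cd False unfolding ef
      by (simp add: comp_e prod_e del: of_nat_prod)
  qed
  have "real (card (trees_above V {e, f})) * real (card V) ^ 2
      = real (card V) ^ card (components V {e, f}) * real (\<Prod>C\<in>components V {e, f}. card C)"
    by (rule card_trees_above) (use assms ab f_ins(1) ef in auto)
  then have "real (card (trees_above V {e, f})) * real (card V) ^ 2 * real (card V) ^ 2
      = real (card V) ^ (card (components V {e, f}) + 2) * real (\<Prod>C\<in>components V {e, f}. card C)"
    by (simp add: power_add power2_eq_square mult_ac del: of_nat_prod)
  then show ?thesis
    unfolding card_ef prod_ef by (simp add: mult_ac flip: power_add)
qed

lemma spanning_trees_complete:
  assumes "snd G = edges_on (fst G)"
  shows "spanning_trees G = trees_above (fst G) {}"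
proof -
  have "(\<nexists>vs. graph_cycle (fst G, T) vs) \<longleftrightarrow> forest T" if "T \<subseteq> edges_on (fst G)" for T
    using that by (subst forest_iff_no_cycle[of T "fst G"]) (auto simp: edges_on_def)
  then show ?thesis
    by (auto simp: spanning_trees_def trees_above_def tree_graph_def assms)
qed

section \<open>The Hessian of the complete graph\<close>

text \<open>Differentiation and evaluation are additive, so each spanning tree contributes 1 or 0
  according to whether it contains the two distinct edges.\<close>

lemma meval_ones_hessian_kirchhoff:
  assumes "finite (fst G)" and G: "snd G = edges_on (fst G)"
  shows "meval (\<lambda>_. 1) (mpderiv e (mpderiv f (kirchhoff_poly G)))
    = (if e = f then 0 else real (card (trees_above (fst G) {e, f})))"
proof -
  have fin: "finite (spanning_trees G)" "\<And>T. T \<in> spanning_trees G \<Longrightarrow> finite T"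
    using finite_subset[OF _ finite_edges_on[OF assms(1)]] finite_edges_on[OF assms(1)]
    by (auto simp: spanning_trees_def G)
  have "meval (\<lambda>_. 1) (mpderiv e (mpderiv f (kirchhoff_poly G)))
      = (\<Sum>T\<in>spanning_trees G. if e \<noteq> f \<and> e \<in> T \<and> f \<in> T then 1 else 0)"
    unfolding kirchhoff_poly_def mpderiv_sum meval_sum
    by (intro sum.cong refl meval_ones_mpderiv2_prod_mvar fin(2))
  also have "\<dots> = (if e = f then 0 else real (card (spanning_trees G \<inter> {T. e \<in> T \<and> f \<in> T})))"
    using fin(1) by (simp add: sum.If_cases)
  also have "spanning_trees G \<inter> {T. e \<in> T \<and> f \<in> T} = trees_above (fst G) {e, f}"
    unfolding spanning_trees_complete[OF G] by (auto simp: trees_above_def)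
  finally show ?thesis .
qed

text \<open>Turns the division-free tree count into one with the integer exponent
  \<open>n - 4\<close>, which is -1 for \<open>n = 3\<close>.\<close>

lemma power_int_diff_nat:
  fixes x :: "'a::field"
  assumes "x \<noteq> 0" and "y * x ^ b = z * x ^ a"
  shows "y = z * x powi (int a - int b)"
  using assms by (simp add: power_int_diff field_simps)

theorem theorem3p4:
  fixes n :: nat and es :: "nat set list"
  assumes "n \<ge> 3"
    and "distinct es" and "set es = snd (complete_graph n)"
  shows "det (map_mat (meval (\<lambda>_. 1)) (hessian_mat es (kirchhoff_poly (complete_graph n)))) =
           (- 1) powi (int (n choose 2) - 1)
           * 2 powi (int (n choose 2) - int n + 1)
           * real n powi (int n + int (n choose 2) * (int n - 4))
           * (real n - 2)
         \<and> det (hessian_mat es (kirchhoff_poly (complete_graph n))) \<noteq> 0"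
proof -
  let ?G = "complete_graph n"
  let ?H = "hessian_mat es (kirchhoff_poly ?G)"
  define N where "N = n choose 2"
  have fst_G: "fst ?G = {1..n}" and snd_G: "snd ?G = edges_on (fst ?G)"
    by (auto simp: complete_graph_def edges_on_def)
  have es: "set es = {e. e \<subseteq> {1..n} \<and> card e = 2}"
    using assms(3) by (simp add: complete_graph_def)
  have len: "length es = N"
    using n_subsets[of "{1..n}" 2] distinct_card[OF assms(2)] es by (simp add: N_def)
  let ?A = "mat N N (\<lambda>(i, j). (if i = j then 0 else 4 - real (card (es ! i \<inter> es ! j))))"
  have "map_mat (meval (\<lambda>_. 1)) ?H = real n powi (int n - 4) \<cdot>\<^sub>m ?A"
  proof (rule eq_matI)
    fix i j
    assume "i < dim_row (real n powi (int n - 4) \<cdot>\<^sub>m ?A)"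
      and "j < dim_col (real n powi (int n - 4) \<cdot>\<^sub>m ?A)"
    then have ij: "i < N" "j < N"
      by auto
    have "real (card (trees_above {1..n} {es ! i, es ! j}))
        = (4 - real (card (es ! i \<inter> es ! j))) * real n powi (int n - int 4)" if "i \<noteq> j"
    proof (rule power_int_diff_nat)
      have "es ! i \<in> edges_on {1..n}" "es ! j \<in> edges_on {1..n}" "es ! i \<noteq> es ! j"
        using ij len es assms(2) that nth_mem[of _ es]
        by (auto simp: edges_on_def nth_eq_iff_index_eq)
      then show "real (card (trees_above {1..n} {es ! i, es ! j})) * real n ^ 4
          = (4 - real (card (es ! i \<inter> es ! j))) * real n ^ n"
        using card_trees_above_two_edges[of "{1..n}" "es ! i" "es ! j"] by simp
    qed (use assms(1) in simp)
    then show "map_mat (meval (\<lambda>_. 1)) ?H $$ (i, j) = (real n powi (int n - 4) \<cdot>\<^sub>m ?A) $$ (i, j)"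
      using ij len assms(2) meval_ones_hessian_kirchhoff[OF _ snd_G]
      by (auto simp: hessian_mat_def fst_G nth_eq_iff_index_eq)
  qed (auto simp: hessian_mat_def len)
  then have det: "det (map_mat (meval (\<lambda>_. 1)) ?H) = (real n powi (int n - 4)) ^ N
      * ((- 2) ^ (N - n) * ((- real n) ^ (n - 1) * (2 * real n * (real n - 2))))"
    using det_edge_intersection_mat[OF assms(1,2) es] len by simp
  have "n * 2 \<le> n * (n - 1)"
    using assms(1) by (intro mult_le_mono2) simp
  then have nN: "n \<le> N"
    unfolding N_def choose_two by linarith
  \<comment> \<open>The signs come from \<open>(- 2) ^ (N - n)\<close> and
    \<open>(- n) ^ (n - 1)\<close>, whose exponents add up to \<open>N - 1\<close>.\<close>
  have sign: "(- 1 :: real) powi (int N - 1) = (- 1) ^ (N - n) * (- 1) ^ (n - 1)"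
  proof -
    have "int N - 1 = int ((N - n) + (n - 1))"
      using nN assms(1) by simp
    then show ?thesis
      by (simp only: power_int_of_nat power_add)
  qed
  have two: "(2 :: real) powi (int N - int n + 1) = 2 ^ (N - n) * 2"
  proof -
    have "int N - int n + 1 = int (Suc (N - n))"
      using nN by simp
    then show ?thesis
      by (simp only: power_int_of_nat power_Suc2)
  qed
  \<comment> \<open>The scalar pulled out of the matrix contributes its \<open>N\<close>-th power.
    The remaining \<open>n ^ n\<close> combines \<open>n ^ (n - 1)\<close> with the \<open>n\<close>
    of the factor \<open>2 n (n - 2)\<close>.\<close>
  have pow_n: "real n powi (int n + int N * (int n - 4))
      = (real n powi (int n - 4)) ^ N * (real n ^ (n - 1) * real n)"
  proof -
    have "real n powi (int n + int N * (int n - 4)) = real n ^ n * real n powi ((int n - 4) * int N)"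
      using assms(1) by (simp add: power_int_add mult.commute)
    also have "real n powi ((int n - 4) * int N) = (real n powi (int n - 4)) ^ N"
      by (simp only: power_int_mult power_int_of_nat)
    also have "real n ^ n = real n ^ (n - 1) * real n"
      using assms(1) by (cases n) auto
    finally show ?thesis
      by (simp add: mult.commute)
  qed
  have det_ones: "det (map_mat (meval (\<lambda>_. 1)) ?H) =
      (- 1) powi (int N - 1) * 2 powi (int N - int n + 1)
      * real n powi (int n + int N * (int n - 4)) * (real n - 2)"
    unfolding det sign two pow_n
    by (subst (1) power_minus, subst (1) power_minus[of "real n"]) (simp only: mult_ac)
  \<comment> \<open>If the polynomial determinant vanished, so would its value at the all-ones
    point; but \<open>n \<ge> 3\<close> makes every factor of \<open>det_ones\<close>
    nonzero.\<close>
  moreover have "det ?H \<noteq> 0"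
  proof
    interpret comm_ring_hom "meval (\<lambda>_ :: nat set. 1 :: real)"
      by (rule comm_ring_hom_meval)
    assume "det ?H = 0"
    then have "det (map_mat (meval (\<lambda>_. 1)) ?H) = 0"
      by simp
    then show False
      using assms(1) unfolding det_ones by simp
  qed
  ultimately show ?thesis
    unfolding N_def by blast
qed

end
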